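(* Let $v_1, \dots, v_m \in \mathbb{R}^d$ be a tight frame, i.e. $\sum_{i=1}^m v_i \otimes v_i = \mathrm{Id}_d$, such that $0$ lies in the interior of $\mathrm{conv}\{v_1, \dots, v_m\}$, and put \[ C = \{x \in \mathbb{R}^d : \langle v_i, x\rangle \leq 1 \text{ for } i = 1, \dots, m\}. \] Let $Q$ be a positive definite (self-adjoint) operator on $\mathbb{R}^d$ with eigenvalues $\lambda_1 \geq \dots \geq \lambda_d > 0$. Then \[ \max_{x \in C} \langle Qx, x\rangle \;\geq\; \sum_{k=1}^d c_{m,k}\, \lambda_k, \qquad \text{where } c_{m,k} = \frac{m^2}{(m-k)(m-k+1)}. \]
   Context: $\langle\cdot,\cdot\rangle$ is the Euclidean inner product on $\mathbb{R}^d$, $(v \otimes v)x = \langle v, x\rangle v$, and $\mathrm{Id}_d$ is the identity operator on $\mathbb{R}^d$. The condition that $0$ is an interior point of the convex hull forces $m > d$, so the coefficients $c_{m,k}$, $1 \leq k \leq d$, are well defined. *)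

theory Defs
  imports "HOL-Analysis.Analysis"
begin

definition tensor_square :: "real ^ 'n \<Rightarrow> real ^ 'n \<Rightarrow> real ^ 'n" where
  "tensor_square v x = (v \<bullet> x) *\<^sub>R v"

definition tight_frame :: "nat \<Rightarrow> (nat \<Rightarrow> real ^ 'n) \<Rightarrow> bool" where
  "tight_frame m v \<longleftrightarrow> (\<lambda>x. \<Sum>i=1..m. tensor_square (v i) x) = id"

definition frame_polytope :: "nat \<Rightarrow> (nat \<Rightarrow> real ^ 'n) \<Rightarrow> (real ^ 'n) set" where
  "frame_polytope m v = {x. \<forall>i\<in>{1..m}. v i \<bullet> x \<le> 1}"

definition self_adjoint :: "(real ^ 'n \<Rightarrow> real ^ 'n) \<Rightarrow> bool" where
  "self_adjoint Q \<longleftrightarrow> linear Q \<and> (\<forall>x y. Q x \<bullet> y = x \<bullet> Q y)"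

definition positive_definite :: "(real ^ 'n \<Rightarrow> real ^ 'n) \<Rightarrow> bool" where
  "positive_definite Q \<longleftrightarrow> self_adjoint Q \<and> (\<forall>x. x \<noteq> 0 \<longrightarrow> Q x \<bullet> x > 0)"

definition eigenspace :: "(real ^ 'n \<Rightarrow> real ^ 'n) \<Rightarrow> real \<Rightarrow> (real ^ 'n) set" where
  "eigenspace Q \<mu> = {x. Q x = \<mu> *\<^sub>R x}"

(* ev 1 \<ge> ... \<ge> ev d lists the eigenvalues of Q with multiplicity: every real \<mu> occurs exactly as often
   as the dimension of its eigenspace (so not at all if it is not an eigenvalue).  For self-adjoint Q
   geometric and algebraic multiplicities agree, and such a list exists and is unique.  Only the
   values of ev on {1..d} matter. *)
definition ordered_eigenvalues :: "(real ^ 'n \<Rightarrow> real ^ 'n) \<Rightarrow> (nat \<Rightarrow> real) \<Rightarrow> bool" where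
  "ordered_eigenvalues Q ev \<longleftrightarrow>
     antimono_on {1..CARD('n)} ev \<and>
     (\<forall>\<mu>. card {k \<in> {1..CARD('n)}. ev k = \<mu>} = dim (eigenspace Q \<mu>))"

definition frame_coeff :: "nat \<Rightarrow> nat \<Rightarrow> real" where
  "frame_coeff m k = (real m)\<^sup>2 / ((real m - real k) * (real m - real k + 1))"

end

theory Submission
  imports Defs
begin

text \<open>
  Write \<open>C\<close> for the polytope, \<open>d\<close> for the dimension, \<open>w\<close> for the sum of the frame vectors, and
  \<open>\<lambda>\<^sub>k\<close> for the ordered eigenvalues, with \<open>\<lambda>\<^bsub>d+1\<^esub> = 0\<close>. The idea is to walk from the origin to a
  vertex of \<open>C\<close> along \<open>d\<close> segments, each of which makes one more of the constraints
  \<open>v\<^sub>i \<bullet> x \<le> 1\<close> tight, and to keep the constraints that are tight already.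

  Two facts drive the estimate. First, if \<open>j\<close> constraints are tight at \<open>x\<close>, then
  \<open>x \<bullet> x \<ge> j / (m - j) * (m - 2 * (w \<bullet> x))\<close>, a bound that is affine in \<open>x\<close>
  (\<open>norm_ge_of_tight_constraints\<close>); at \<open>x = 0\<close> its right-hand side is \<open>m * j / (m - j)\<close>, the sum
  of the first \<open>j\<close> coefficients. Second, for any \<open>k < d\<close> constraints there
  is a direction \<open>y \<noteq> 0\<close> orthogonal to the corresponding \<open>v\<^sub>i\<close> with
  \<open>Q y \<bullet> y \<ge> \<lambda>\<^bsub>k+1\<^esub> * (y \<bullet> y)\<close>: the eigenvectors for the \<open>k + 1\<close> largest eigenvalues span a space
  of dimension at least \<open>k + 1\<close> (\<open>large_subspace_of_ordered_eigenvalues\<close>).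

  Heuristically, replace the walk by a random one that leaves each point in one of the two
  directions \<open>\<plusminus>y\<close>, with probabilities that make it a martingale. Its position \<open>X\<^sub>j\<close> after \<open>j\<close> steps
  then satisfies \<open>E (X\<^sub>j \<bullet> X\<^sub>j) \<ge> m * j / (m - j)\<close> by the first fact, and by the second one the expected
  growth of \<open>Q x \<bullet> x\<close> in step \<open>k\<close> is at least \<open>\<lambda>\<^sub>k\<close> times that of \<open>x \<bullet> x\<close>. Summation by parts
  turns this into \<open>\<Sum> c\<^sub>k \<lambda>\<^sub>k\<close>, because the \<open>\<lambda>\<^sub>k\<close> decrease.

  The proof removes the randomness. The lower bound for the conditional expectation of the final
  value, given that the walk is at \<open>x\<close> after \<open>k\<close> steps, is
  \<open>Q x \<bullet> x - \<lambda>\<^bsub>k+1\<^esub> * (x \<bullet> x) + (\<Sum>j>k. (\<lambda>\<^sub>j - \<lambda>\<^bsub>j+1\<^esub>) * j / (m - j)) * (m - 2 * (w \<bullet> x))\<close>.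
  It is convex along \<open>y\<close>, hence nondecreasing on one of the two rays from \<open>x\<close>, and the walk
  follows this ray (\<open>vertex_walk_bound\<close>).
\<close>

section \<open>Subspaces on which a self-adjoint operator is large\<close>

lemma nonzero_orthogonal_vector_in_subspace:
  fixes V U :: "'a::euclidean_space set"
  assumes "subspace V" "finite U" "card U < dim V"
  obtains y where "y \<in> V" "y \<noteq> 0" "\<And>u. u \<in> U \<Longrightarrow> u \<bullet> y = 0"
proof -
  define W where "W = {y. \<forall>x\<in>span U. orthogonal x y}"
  have W: "subspace W"
    unfolding W_def subspace_def by (auto simp: orthogonal_clauses)
  have "dim W + dim (span U) = DIM('a)"
    using dim_subspace_orthogonal_to_vectors[of "span U" UNIV] by (simp add: W_def)
  moreover have "dim (span U) \<le> card U"
    using assms(2) by (simp add: dim_le_card')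
  moreover have "dim {x + y |x y. x \<in> V \<and> y \<in> W} + dim (V \<inter> W) = dim V + dim W"
    by (rule dim_sums_Int[OF assms(1) W])
  moreover have "dim {x + y |x y. x \<in> V \<and> y \<in> W} \<le> DIM('a)"
    by (rule dim_subset_UNIV)
  ultimately have "dim (V \<inter> W) > 0"
    using assms(3) by linarith
  then obtain y where "y \<in> V \<inter> W" "y \<noteq> 0"
    by (metis dim_eq_0 neq0_conv singletonI subsetI)
  then show thesis
    by (intro that) (auto simp: W_def orthogonal_def span_base)
qed

lemma eigenspace_subspace:
  assumes "linear Q"
  shows "subspace (eigenspace Q \<mu>)"
  unfolding eigenspace_def subspace_def
  using assms by (auto simp: linear_0 linear_add linear_scale algebra_simps)

lemma eigenvectors_orthogonal:
  assumes "self_adjoint Q" "x \<in> eigenspace Q \<mu>" "y \<in> eigenspace Q \<nu>" "\<mu> \<noteq> \<nu>"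
  shows "orthogonal x y"
proof -
  have "Q x \<bullet> y = x \<bullet> Q y"
    using assms(1) by (simp add: self_adjoint_def)
  then have "(\<mu> - \<nu>) * (x \<bullet> y) = 0"
    using assms(2,3) by (simp add: eigenspace_def algebra_simps)
  then show ?thesis
    using assms(4) by (simp add: orthogonal_def)
qed

lemma quadratic_form_ge_on_eigenvector_span:
  fixes Q :: "real ^ 'n \<Rightarrow> real ^ 'n"
  assumes "linear Q" "finite B" "pairwise orthogonal B" "\<And>b. b \<in> B \<Longrightarrow> norm b = 1"
    and eig: "\<And>b. b \<in> B \<Longrightarrow> Q b = \<nu> b *\<^sub>R b" and ge: "\<And>b. b \<in> B \<Longrightarrow> \<mu> \<le> \<nu> b"
    and "y \<in> span B"
  shows "\<mu> * (y \<bullet> y) \<le> Q y \<bullet> y"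
proof -
  obtain c where y: "y = (\<Sum>b\<in>B. c b *\<^sub>R b)"
    using assms(2,7) by (auto simp: span_finite)
  have coord: "b \<bullet> y = c b" if "b \<in> B" for b
  proof -
    have "b \<bullet> y = (\<Sum>b'\<in>B. if b' = b then c b else 0)"
      unfolding y inner_sum_right
    proof (rule sum.cong[OF refl])
      fix b' assume "b' \<in> B"
      then show "b \<bullet> (c b' *\<^sub>R b') = (if b' = b then c b else 0)"
        using that assms(3,4)
        by (auto simp: pairwise_def orthogonal_def dot_square_norm)
    qed
    then show ?thesis
      using that assms(2) by simp
  qed
  have "y \<bullet> y = (\<Sum>b\<in>B. c b * (b \<bullet> y))"
    by (subst (1) y) (simp add: inner_sum_left)
  then have yy: "y \<bullet> y = (\<Sum>b\<in>B. (c b)\<^sup>2)"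
    by (simp add: coord power2_eq_square)
  have "Q y = (\<Sum>b\<in>B. (c b * \<nu> b) *\<^sub>R b)"
    unfolding y linear_sum[OF assms(1)] by (simp add: linear_scale[OF assms(1)] eig)
  then have "Q y \<bullet> y = (\<Sum>b\<in>B. c b * \<nu> b * (b \<bullet> y))"
    by (simp add: inner_sum_left)
  then have "Q y \<bullet> y = (\<Sum>b\<in>B. \<nu> b * (c b)\<^sup>2)"
    by (simp add: coord power2_eq_square mult_ac)
  then show ?thesis
    unfolding yy sum_distrib_left by (auto intro!: sum_mono mult_right_mono ge)
qed

text \<open>This replaces the spectral theorem and the Courant-Fischer principle: eigenspaces of distinct
  eigenvalues are orthogonal, so the union of orthonormal bases of the eigenspaces for
  \<open>ev 1, \<dots>, ev k\<close> is independent, and its size is read off from the multiplicities that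
  \<open>ordered_eigenvalues\<close> prescribes.\<close>

lemma large_subspace_of_ordered_eigenvalues:
  fixes Q :: "real ^ 'n \<Rightarrow> real ^ 'n"
  assumes sa: "self_adjoint Q" and ev: "ordered_eigenvalues Q ev"
    and k: "k \<in> {1..CARD('n)}"
  obtains V where "subspace V" "k \<le> dim V" "\<And>y. y \<in> V \<Longrightarrow> ev k * (y \<bullet> y) \<le> Q y \<bullet> y"
proof -
  have lin: "linear Q"
    using sa by (simp add: self_adjoint_def)
  define M where "M = ev ` {1..k}"
  have "\<exists>B. B \<subseteq> eigenspace Q \<mu> \<and> pairwise orthogonal B \<and> (\<forall>b\<in>B. norm b = 1) \<and>
      independent B \<and> card B = dim (eigenspace Q \<mu>)" for \<mu>
    using orthonormal_basis_subspace[OF eigenspace_subspace[OF lin, of \<mu>]] by metis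
  then obtain B where B: "\<And>\<mu>. B \<mu> \<subseteq> eigenspace Q \<mu>" "\<And>\<mu>. pairwise orthogonal (B \<mu>)"
      "\<And>\<mu> b. b \<in> B \<mu> \<Longrightarrow> norm b = 1" "\<And>\<mu>. independent (B \<mu>)"
      "\<And>\<mu>. card (B \<mu>) = dim (eigenspace Q \<mu>)"
    by metis
  have finB: "finite (B \<mu>)" for \<mu>
    using B(4) by (rule independent_imp_finite)
  define A where "A = (\<Union>\<mu>\<in>M. B \<mu>)"
  have finM: "finite M"
    by (simp add: M_def)
  have finA: "finite A"
    using finM finB by (simp add: A_def)
  have norm1: "norm b = 1" if "b \<in> A" for b
    using that B(3) by (auto simp: A_def)
  have orth: "pairwise orthogonal A"
  proof (rule pairwiseI)
    fix a b assume "a \<in> A" "b \<in> A" "a \<noteq> b"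
    then obtain \<mu> \<nu> where *: "a \<in> B \<mu>" "b \<in> B \<nu>"
      by (auto simp: A_def)
    show "orthogonal a b"
    proof (cases "\<mu> = \<nu>")
      case True
      then show ?thesis
        using * B(2)[of \<mu>] \<open>a \<noteq> b\<close> by (auto simp: pairwise_def)
    next
      case False
      then show ?thesis
        using * B(1) eigenvectors_orthogonal[OF sa] by blast
    qed
  qed
  have indep: "independent A"
    using orth norm1 by (intro pairwise_orthogonal_independent) force+
  have disj: "B \<mu> \<inter> B \<nu> = {}" if "\<mu> \<noteq> \<nu>" for \<mu> \<nu>
  proof (rule ccontr)
    assume "B \<mu> \<inter> B \<nu> \<noteq> {}"
    then obtain b where b: "b \<in> B \<mu>" "b \<in> B \<nu>"
      by blast
    then have "orthogonal b b"
      using B(1) eigenvectors_orthogonal[OF sa _ _ that] by blast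
    then show False
      using B(3)[OF b(1)] by (auto simp: orthogonal_self)
  qed
  have "card A = (\<Sum>\<mu>\<in>M. card (B \<mu>))"
    unfolding A_def by (rule card_UN_disjoint) (use finM finB disj in auto)
  also have "\<dots> = (\<Sum>\<mu>\<in>M. card {j \<in> {1..CARD('n)}. ev j = \<mu>})"
    using ev by (simp add: B(5) ordered_eigenvalues_def)
  also have "\<dots> = card (\<Union>\<mu>\<in>M. {j \<in> {1..CARD('n)}. ev j = \<mu>})"
    by (rule card_UN_disjoint[symmetric]) (use finM in auto)
  also have "\<dots> \<ge> card {1..k}"
    by (rule card_mono) (use finM k in \<open>auto simp: M_def\<close>)
  finally have "k \<le> card A"
    by simp
  moreover have eig: "\<exists>\<nu>\<ge>ev k. Q b = \<nu> *\<^sub>R b" if "b \<in> A" for b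
  proof -
    obtain j where j: "j \<in> {1..k}" "b \<in> B (ev j)"
      using \<open>b \<in> A\<close> by (auto simp: A_def M_def)
    have "antimono_on {1..CARD('n)} ev"
      using ev by (simp add: ordered_eigenvalues_def)
    then have "ev k \<le> ev j"
      using j(1) k by (auto simp: monotone_on_def)
    then show ?thesis
      using j(2) B(1)[of "ev j"] by (auto simp: eigenspace_def)
  qed
  ultimately show thesis
  proof (intro that[of "span A"])
    show "ev k * (y \<bullet> y) \<le> Q y \<bullet> y" if "y \<in> span A" for y
    proof -
      obtain \<nu> where "\<And>b. b \<in> A \<Longrightarrow> ev k \<le> \<nu> b \<and> Q b = \<nu> b *\<^sub>R b"
        using eig by metis
      then show ?thesis
        using quadratic_form_ge_on_eigenvector_span[OF lin finA orth norm1 _ _ that, of \<nu> "ev k"]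
        by blast
    qed
  qed (use indep in \<open>simp_all add: dim_eq_card_independent\<close>)
qed

section \<open>The polytope of a frame\<close>

text \<open>This makes the interior point hypothesis quantitative: otherwise all \<open>v i\<close>, and with them their
  convex hull, would lie in a half-space that misses a point of a ball around the origin.
  It gives both the boundedness of the polytope and, for every ray, a constraint that stops it.\<close>

lemma frame_direction_ge_norm:
  fixes v :: "nat \<Rightarrow> real ^ 'n"
  assumes "0 \<in> interior (convex hull (v ` {1..m}))"
  obtains e where "e > 0" "\<And>y. \<exists>i\<in>{1..m}. e * norm y \<le> v i \<bullet> y"
proof -
  obtain e where e: "e > 0" "cball 0 e \<subseteq> convex hull (v ` {1..m})"
    using assms by (auto simp: mem_interior_cball)
  have "\<exists>i\<in>{1..m}. e * norm y \<le> v i \<bullet> y" for y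
  proof (rule ccontr)
    assume "\<not> ?thesis"
    then have "v ` {1..m} \<subseteq> {z. y \<bullet> z < e * norm y}"
      by (force simp: inner_commute)
    then have "convex hull (v ` {1..m}) \<subseteq> {z. y \<bullet> z < e * norm y}"
      by (rule hull_minimal) (rule convex_halfspace_lt)
    moreover have "e *\<^sub>R sgn y \<in> cball 0 e"
      using e(1) by (simp add: norm_sgn)
    ultimately have "y \<bullet> (e *\<^sub>R sgn y) < e * norm y"
      using e(2) by blast
    moreover have "y \<bullet> sgn y = norm y"
      by (cases "y = 0") (simp_all add: sgn_div_norm dot_square_norm power2_eq_square)
    ultimately show False
      by simp
  qed
  with e(1) show thesis
    by (rule that)
qed

lemma compact_frame_polytope:
  fixes v :: "nat \<Rightarrow> real ^ 'n"
  assumes "0 \<in> interior (convex hull (v ` {1..m}))"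
  shows "compact (frame_polytope m v)"
proof -
  obtain e where e: "e > 0" "\<And>y. \<exists>i\<in>{1..m}. e * norm y \<le> v i \<bullet> y"
    using frame_direction_ge_norm[OF assms] by blast
  have "norm x \<le> 1 / e" if "x \<in> frame_polytope m v" for x
  proof -
    obtain i where "i \<in> {1..m}" "e * norm x \<le> v i \<bullet> x"
      using e(2) by blast
    with that have "e * norm x \<le> 1"
      unfolding frame_polytope_def by force
    then show ?thesis
      using e(1) by (simp add: field_simps)
  qed
  then have "bounded (frame_polytope m v)"
    unfolding bounded_iff by blast
  moreover have "frame_polytope m v = (\<Inter>i\<in>{1..m}. {x. v i \<bullet> x \<le> 1})"
    by (auto simp: frame_polytope_def)
  then have "closed (frame_polytope m v)"
    by (auto intro!: closed_halfspace_le)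
  ultimately show ?thesis
    by (simp add: compact_eq_bounded_closed)
qed

text \<open>The constraint that stops the ray strictly increases along it. Hence it is not among the
  constraints that are constant in direction \<open>y\<close>, so it is new.\<close>

lemma ray_hits_new_facet:
  fixes v :: "nat \<Rightarrow> real ^ 'n"
  assumes "0 \<in> interior (convex hull (v ` {1..m}))"
    and x: "x \<in> frame_polytope m v" and "y \<noteq> 0"
  obtains t i where "t \<ge> 0" "x + t *\<^sub>R y \<in> frame_polytope m v" "i \<in> {1..m}"
    "v i \<bullet> y > 0" "v i \<bullet> (x + t *\<^sub>R y) = 1"
proof -
  obtain e where e: "e > 0" "\<And>y. \<exists>i\<in>{1..m}. e * norm y \<le> v i \<bullet> y"
    using frame_direction_ge_norm[OF assms(1)] by blast
  define P where "P = {i \<in> {1..m}. v i \<bullet> y > 0}"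
  (* r i is the time at which the ray reaches the hyperplane of the i-th constraint. *)
  define r where "r i = (1 - v i \<bullet> x) / (v i \<bullet> y)" for i
  have "e * norm y > 0"
    using e(1) \<open>y \<noteq> 0\<close> by simp
  then have "P \<noteq> {}"
    using e(2)[of y] by (force simp: P_def)
  moreover have "finite P"
    by (simp add: P_def)
  ultimately obtain i where i: "i \<in> P" "\<And>j. j \<in> P \<Longrightarrow> r i \<le> r j"
    using arg_min_if_finite[of P r] by (metis not_le)
  have slack: "v j \<bullet> x \<le> 1" if "j \<in> {1..m}" for j
    using x that by (simp add: frame_polytope_def)
  have r0: "r i \<ge> 0"
    using i(1) slack by (simp add: r_def P_def)
  show thesis
  proof (rule that[of "r i" i])
    show "x + r i *\<^sub>R y \<in> frame_polytope m v"
      unfolding frame_polytope_def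
    proof (safe)
      fix j assume j: "j \<in> {1..m}"
      show "v j \<bullet> (x + r i *\<^sub>R y) \<le> 1"
      proof (cases "j \<in> P")
        case True
        then have "r i \<le> (1 - v j \<bullet> x) / (v j \<bullet> y)"
          using i(2) by (simp add: r_def)
        then show ?thesis
          using True by (simp add: P_def pos_le_divide_eq inner_add_right)
      next
        case False
        then have "r i * (v j \<bullet> y) \<le> 0"
          using j r0 by (simp add: P_def mult_nonneg_nonpos)
        then show ?thesis
          using slack[OF j] by (simp add: inner_add_right)
      qed
    qed
    show "v i \<bullet> (x + r i *\<^sub>R y) = 1"
      using i(1) by (simp add: P_def r_def inner_add_right)
  qed (use r0 i(1) in \<open>auto simp: P_def\<close>)
qed

lemma frame_card_gt_dim:
  fixes v :: "nat \<Rightarrow> real ^ 'n"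
  assumes "0 \<in> interior (convex hull (v ` {1..m}))"
  shows "CARD('n) < m"
proof (rule ccontr)
  assume "\<not> ?thesis"
  then have "card (v ` {1..m}) \<le> DIM(real ^ 'n)"
    using card_image_le[of "{1..m}" v] by simp
  then show False
    using assms empty_interior_convex_hull[of "v ` {1..m}"] by simp
qed

lemma tight_frame_inner_self:
  assumes "tight_frame m v"
  shows "x \<bullet> x = (\<Sum>i=1..m. (v i \<bullet> x)\<^sup>2)"
proof -
  have "(\<Sum>i=1..m. tensor_square (v i) x) = x"
    using assms unfolding tight_frame_def by (metis id_apply)
  then have "x \<bullet> x = (\<Sum>i=1..m. tensor_square (v i) x) \<bullet> x"
    by simp
  then show ?thesis
    by (simp add: inner_sum_left tensor_square_def power2_eq_square)
qed

text \<open>The slacks \<open>s\<^sub>i = 1 - v\<^sub>i \<bullet> x\<close> add up to \<open>m - w \<bullet> x\<close>, with \<open>w\<close> the sum of all \<open>v\<^sub>i\<close>, and at most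
  \<open>m - j\<close> of them are nonzero; this forces their squares, and hence \<open>x \<bullet> x = \<Sum> (1 - s\<^sub>i)\<^sup>2\<close>, to have
  a large sum. Instead of the sharper Cauchy-Schwarz bound, its tangent at slack sum \<open>m\<close>, the value
  at the origin, is used: it loses nothing there and is affine in \<open>x\<close>, so it does not affect the
  second-order behaviour of the function that the walk follows.\<close>

lemma norm_ge_of_tight_constraints:
  fixes v :: "nat \<Rightarrow> real ^ 'n"
  assumes "tight_frame m v" and T: "T \<subseteq> {1..m}" "card T = j" "j < m"
    and tight: "\<And>i. i \<in> T \<Longrightarrow> v i \<bullet> x = 1"
  shows "x \<bullet> x \<ge> j / (real m - j) * (m - 2 * ((\<Sum>i=1..m. v i) \<bullet> x))"
proof -
  define p where "p i = v i \<bullet> x" for i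
  define R where "R = {1..m} - T"
  define n where "n = real m - j"
  have finT: "finite T"
    using T(1) finite_subset by blast
  have n: "n > 0" "real (card R) = n"
    using T card_mono[of "{1..m}" T] finT
    by (auto simp: n_def R_def card_Diff_subset of_nat_diff)
  have split: "(\<Sum>i=1..m. f i) = (\<Sum>i\<in>R. f i) + (\<Sum>i\<in>T. f i)" for f :: "nat \<Rightarrow> real"
    unfolding R_def using T(1) by (rule sum.subset_diff) simp
  define a where "a = (\<Sum>i\<in>R. p i)"
  define b where "b = (\<Sum>i\<in>R. (p i)\<^sup>2)"
  have xx: "x \<bullet> x = b + j"
    unfolding tight_frame_inner_self[OF assms(1)] split b_def p_def
    using tight T(2) by simp
  have w: "(\<Sum>i=1..m. v i) \<bullet> x = a + j"
    unfolding inner_sum_left split a_def p_def using tight T(2) by simp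
  (* Equality holds when all remaining slacks are m / (m - j), that is, p i = - j / n. *)
  have "0 \<le> (\<Sum>i\<in>R. (p i + j / n)\<^sup>2)"
    by (intro sum_nonneg) simp
  also have "\<dots> = (\<Sum>i\<in>R. (p i)\<^sup>2 + 2 * (j / n) * p i + (j / n)\<^sup>2)"
    by (simp add: power2_sum mult_ac add_ac)
  also have "\<dots> = b + 2 * (j / n) * a + n * (j / n)\<^sup>2"
    by (simp only: sum.distrib a_def b_def n(2) sum_distrib_left[symmetric] sum_constant)
  finally have "b + j \<ge> j - 2 * (j / n) * a - n * (j / n)\<^sup>2"
    by simp
  also have "j - 2 * (j / n) * a - n * (j / n)\<^sup>2 = j / n * (m - 2 * (a + j))"
  proof -
    have "real m = n + j"
      by (simp add: n_def)
    then show ?thesis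
      using n(1) by (simp add: field_simps power2_eq_square)
  qed
  finally show ?thesis
    unfolding xx w n_def .
qed

section \<open>Walking to a vertex\<close>

text \<open>The function \<open>x \<mapsto> Q x \<bullet> x - \<mu> * (x \<bullet> x) + u \<bullet> x\<close> is a quadratic polynomial in the position on
  the line through \<open>x\<close> in direction \<open>y\<close>, with leading coefficient \<open>Q y \<bullet> y - \<mu> * (y \<bullet> y) \<ge> 0\<close>; the
  sign \<open>s\<close> makes its slope at \<open>x\<close> nonnegative.\<close>

lemma convex_quadratic_mono_on_some_ray:
  fixes Q :: "real ^ 'n \<Rightarrow> real ^ 'n"
  assumes "self_adjoint Q" and "\<mu> * (y \<bullet> y) \<le> Q y \<bullet> y"
  obtains s where "s = 1 \<or> s = -1"
    "\<And>t. t \<ge> 0 \<Longrightarrow> Q x \<bullet> x - \<mu> * (x \<bullet> x) + u \<bullet> x \<le>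
       Q (x + t *\<^sub>R s *\<^sub>R y) \<bullet> (x + t *\<^sub>R s *\<^sub>R y)
         - \<mu> * ((x + t *\<^sub>R s *\<^sub>R y) \<bullet> (x + t *\<^sub>R s *\<^sub>R y)) + u \<bullet> (x + t *\<^sub>R s *\<^sub>R y)"
proof -
  define g where "g = 2 * (Q x \<bullet> y) - 2 * \<mu> * (x \<bullet> y) + u \<bullet> y"
  define s :: real where "s = (if g \<ge> 0 then 1 else -1)"
  have lin: "linear Q" and sym: "Q y \<bullet> x = Q x \<bullet> y"
    using assms(1) by (auto simp: self_adjoint_def inner_commute)
  have expand: "Q (x + r *\<^sub>R y) \<bullet> (x + r *\<^sub>R y) - \<mu> * ((x + r *\<^sub>R y) \<bullet> (x + r *\<^sub>R y))
       + u \<bullet> (x + r *\<^sub>R y)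
     = Q x \<bullet> x - \<mu> * (x \<bullet> x) + u \<bullet> x + r * g + r\<^sup>2 * (Q y \<bullet> y - \<mu> * (y \<bullet> y))" for r
    by (simp add: linear_add[OF lin] linear_scale[OF lin] inner_add_left inner_add_right sym
        inner_commute[of y x] g_def power2_eq_square algebra_simps)
  show thesis
  proof (rule that[of s])
    show "s = 1 \<or> s = -1"
      by (simp add: s_def)
    fix t :: real assume "t \<ge> 0"
    have "t * (s * g) \<ge> 0"
      using \<open>t \<ge> 0\<close> by (simp add: s_def)
    moreover have "(t * s)\<^sup>2 * (Q y \<bullet> y - \<mu> * (y \<bullet> y)) \<ge> 0"
      using assms(2) by simp
    ultimately show "Q x \<bullet> x - \<mu> * (x \<bullet> x) + u \<bullet> x \<le>
       Q (x + t *\<^sub>R s *\<^sub>R y) \<bullet> (x + t *\<^sub>R s *\<^sub>R y)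
         - \<mu> * ((x + t *\<^sub>R s *\<^sub>R y) \<bullet> (x + t *\<^sub>R s *\<^sub>R y)) + u \<bullet> (x + t *\<^sub>R s *\<^sub>R y)"
      using expand[of "t * s"] by (simp add: mult.assoc)
  qed
qed

text \<open>One step of the walk, from \<open>k\<close> to \<open>k + 1\<close> tight constraints, is one step of a downward
  induction. The right-hand side is convex along the chosen direction, so it does not decrease on
  the way to the next facet at \<open>x'\<close>. There, with one more tight constraint, the lower bound for
  \<open>x' \<bullet> x'\<close> allows the factor \<open>lam (k + 1)\<close> to be exchanged for \<open>lam (k + 2)\<close>.\<close>

lemma vertex_walk_bound:
  fixes v :: "nat \<Rightarrow> real ^ 'n" and m :: nat and lam :: "nat \<Rightarrow> real"
  defines "C \<equiv> frame_polytope m v" and "w \<equiv> \<Sum>i=1..m. v i"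
  assumes frame: "tight_frame m v" and zero: "0 \<in> interior (convex hull (v ` {1..m}))"
    and sa: "self_adjoint Q"
    and V: "\<And>k. k \<in> {1..CARD('n)} \<Longrightarrow> \<exists>V. subspace V \<and> k \<le> dim V \<and>
       (\<forall>y\<in>V. lam k * (y \<bullet> y) \<le> Q y \<bullet> y)"
    and anti: "\<And>k. k \<in> {1..CARD('n)} \<Longrightarrow> lam (Suc k) \<le> lam k"
    and last: "lam (Suc CARD('n)) = 0"
    and k: "k \<le> CARD('n)"
    and x: "x \<in> C" and T: "T \<subseteq> {1..m}" "card T = k" "\<And>i. i \<in> T \<Longrightarrow> v i \<bullet> x = 1"
  shows "\<exists>z\<in>C. Q z \<bullet> z \<ge> Q x \<bullet> x - lam (Suc k) * (x \<bullet> x) +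
    (\<Sum>j\<in>{Suc k..CARD('n)}. (lam j - lam (Suc j)) * (j / (real m - j))) * (m - 2 * (w \<bullet> x))"
  using k x T
proof (induction k arbitrary: x T rule: inc_induct)
  case base
  then show ?case
    using last by auto
next
  case (step k)
  let ?d = "CARD('n)"
  define \<beta> where
    "\<beta> k = (\<Sum>j\<in>{Suc k..?d}. (lam j - lam (Suc j)) * (j / (real m - j)))" for k
  have md: "?d < m"
    by (rule frame_card_gt_dim[OF zero])
  have \<beta>_Suc: "\<beta> k = (lam (Suc k) - lam (Suc (Suc k))) * (Suc k / (real m - Suc k)) + \<beta> (Suc k)"
    unfolding \<beta>_def using step.hyps by (subst sum.atLeast_Suc_atMost) auto
  have Suc_k: "Suc k \<in> {1..?d}"
    using step.hyps by simp
  obtain V where V: "subspace V" "Suc k \<le> dim V"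
      "\<And>y. y \<in> V \<Longrightarrow> lam (Suc k) * (y \<bullet> y) \<le> Q y \<bullet> y"
    using V[OF Suc_k] by blast
  have finT: "finite T"
    using step.prems(2) finite_subset by blast
  have "card (v ` T) < dim V"
    using card_image_le[OF finT, of v] step.prems(3) V(2) by simp
  then obtain y where y: "y \<in> V" "y \<noteq> 0" "\<And>i. i \<in> T \<Longrightarrow> v i \<bullet> y = 0"
    using nonzero_orthogonal_vector_in_subspace[OF V(1), of "v ` T"] finT by (metis finite_imageI imageI)
  obtain s :: real where s: "s = 1 \<or> s = -1" and
    mono: "\<And>t. t \<ge> 0 \<Longrightarrow>
       Q x \<bullet> x - lam (Suc k) * (x \<bullet> x) + (- (2 * \<beta> k) *\<^sub>R w) \<bullet> x \<le>
       Q (x + t *\<^sub>R s *\<^sub>R y) \<bullet> (x + t *\<^sub>R s *\<^sub>R y)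
         - lam (Suc k) * ((x + t *\<^sub>R s *\<^sub>R y) \<bullet> (x + t *\<^sub>R s *\<^sub>R y))
         + (- (2 * \<beta> k) *\<^sub>R w) \<bullet> (x + t *\<^sub>R s *\<^sub>R y)"
    using convex_quadratic_mono_on_some_ray[OF sa V(3)[OF y(1)]] by blast
  have "s *\<^sub>R y \<noteq> 0"
    using s y(2) by auto
  then obtain t i where t: "t \<ge> 0" "x + t *\<^sub>R s *\<^sub>R y \<in> C" "i \<in> {1..m}"
    "v i \<bullet> (s *\<^sub>R y) > 0" "v i \<bullet> (x + t *\<^sub>R s *\<^sub>R y) = 1"
    using ray_hits_new_facet[OF zero step.prems(1)[unfolded C_def]] unfolding C_def by metis
  define x' where "x' = x + t *\<^sub>R s *\<^sub>R y"
  have new: "i \<notin> T"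
    using t(4) y(3) by auto
  have T': "insert i T \<subseteq> {1..m}" "card (insert i T) = Suc k"
    using step.prems(2,3) t(3) new finT by auto
  have tight': "v j \<bullet> x' = 1" if "j \<in> insert i T" for j
    using that t(5) step.prems(4) y(3) by (auto simp: x'_def inner_add_right)
  obtain z where z: "z \<in> C"
    "Q z \<bullet> z \<ge> Q x' \<bullet> x' - lam (Suc (Suc k)) * (x' \<bullet> x') + \<beta> (Suc k) * (m - 2 * (w \<bullet> x'))"
    using step.IH[OF t(2)[folded x'_def] T' tight'] unfolding \<beta>_def by blast
  have "x' \<bullet> x' \<ge> Suc k / (real m - Suc k) * (m - 2 * (w \<bullet> x'))"
    unfolding w_def
    by (rule norm_ge_of_tight_constraints[OF frame T' _ tight']) (use Suc_k md in auto)
  then have "(lam (Suc k) - lam (Suc (Suc k))) * (x' \<bullet> x') \<ge>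
      (lam (Suc k) - lam (Suc (Suc k))) * (Suc k / (real m - Suc k) * (m - 2 * (w \<bullet> x')))"
    using anti[OF Suc_k] by (intro mult_left_mono) auto
  then have "Q x' \<bullet> x' - lam (Suc k) * (x' \<bullet> x') + \<beta> k * (m - 2 * (w \<bullet> x')) \<le> Q z \<bullet> z"
    using z(2) unfolding \<beta>_Suc by (simp only: algebra_simps)
  moreover have "Q x \<bullet> x - lam (Suc k) * (x \<bullet> x) + \<beta> k * (m - 2 * (w \<bullet> x)) \<le>
      Q x' \<bullet> x' - lam (Suc k) * (x' \<bullet> x') + \<beta> k * (m - 2 * (w \<bullet> x'))"
    using mono[OF t(1)] unfolding x'_def[symmetric] by (simp add: algebra_simps)
  ultimately show ?case
    using z(1) unfolding \<beta>_def by (meson order_trans)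
qed

section \<open>The coefficients and the theorem\<close>

text \<open>The partial sums of the coefficients telescope:
  \<open>(\<Sum>k=1..j. frame_coeff m k) = m * (j / (m - j))\<close>. This is the value at the origin of the
  lower bound in \<open>norm_ge_of_tight_constraints\<close>, which is how the coefficients enter.\<close>

lemma frame_coeff_summation_by_parts:
  assumes "n < m"
  shows "m * (\<Sum>j=1..n. (lam j - lam (Suc j)) * (j / (real m - j)))
    = (\<Sum>k=1..n. frame_coeff m k * lam k) - m * (n / (real m - n)) * lam (Suc n)"
  using assms
proof (induction n)
  case (Suc n)
  define r where "r = (\<lambda>j::nat. j / (real m - j))"
  define a where "a = real m - Suc n"
  have a: "a > 0" "real m - n = a + 1" "real m = a + 1 + n"
    using Suc.prems by (auto simp: a_def)
  have coeff: "frame_coeff m (Suc n) = m * r (Suc n) - m * r n"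
    unfolding frame_coeff_def r_def a_def[symmetric] a(2)
    using a(1) by (simp add: a(3) field_simps power2_eq_square)
  have IH: "m * (\<Sum>j=1..n. (lam j - lam (Suc j)) * r j)
    = (\<Sum>k=1..n. frame_coeff m k * lam k) - m * r n * lam (Suc n)"
    using Suc by (simp add: r_def)
  have "m * (\<Sum>j=1..Suc n. (lam j - lam (Suc j)) * r j)
    = m * (\<Sum>j=1..n. (lam j - lam (Suc j)) * r j) + m * (lam (Suc n) - lam (Suc (Suc n))) * r (Suc n)"
    by (simp add: algebra_simps)
  also have "\<dots> = (\<Sum>k=1..Suc n. frame_coeff m k * lam k) - m * r (Suc n) * lam (Suc (Suc n))"
    unfolding IH by (simp add: coeff algebra_simps)
  finally show ?case
    by (simp add: r_def)
qed simp

theorem theorem6p1: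
  fixes v :: "nat \<Rightarrow> real ^ 'n"
    and m :: nat
    and Q :: "real ^ 'n \<Rightarrow> real ^ 'n"
    and ev :: "nat \<Rightarrow> real"
  assumes "tight_frame m v"
    and "0 \<in> interior (convex hull (v ` {1..m}))"
    and "positive_definite Q"
    and "ordered_eigenvalues Q ev"
    and "ev CARD('n) > 0"
  shows "\<exists>x\<in>frame_polytope m v.
           (\<forall>y\<in>frame_polytope m v. Q y \<bullet> y \<le> Q x \<bullet> x) \<and>
           Q x \<bullet> x \<ge> (\<Sum>k=1..CARD('n). frame_coeff m k * ev k)"
proof -
  let ?d = "CARD('n)" and ?C = "frame_polytope m v"
  have sa: "self_adjoint Q"
    using assms(3) by (simp add: positive_definite_def)
  then have lin: "linear Q"
    by (simp add: self_adjoint_def)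
  (* The walk ends after d steps; the value 0 beyond d reduces the bound at its end to Q x \<bullet> x. *)
  define lam where "lam k = (if k \<le> ?d then ev k else 0)" for k
  have md: "?d < m"
    by (rule frame_card_gt_dim[OF assms(2)])
  have zero: "0 \<in> ?C"
    by (simp add: frame_polytope_def)
  have V: "\<exists>V. subspace V \<and> k \<le> dim V \<and> (\<forall>y\<in>V. lam k * (y \<bullet> y) \<le> Q y \<bullet> y)"
    if "k \<in> {1..?d}" for k
    using large_subspace_of_ordered_eigenvalues[OF sa assms(4) that] that
    by (metis atLeastAtMost_iff lam_def)
  have anti: "lam (Suc k) \<le> lam k" if "k \<in> {1..?d}" for k
  proof (cases "k = ?d")
    case False
    have "antimono_on {1..?d} ev"
      using assms(4) by (simp add: ordered_eigenvalues_def)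
    then show ?thesis
      using that False by (auto simp: lam_def monotone_on_def)
  qed (use assms(5) in \<open>simp add: lam_def\<close>)
  have "\<exists>z\<in>?C. Q z \<bullet> z \<ge> Q 0 \<bullet> 0 - lam (Suc 0) * (0 \<bullet> (0 :: real ^ 'n)) +
    (\<Sum>j\<in>{Suc 0..?d}. (lam j - lam (Suc j)) * (j / (real m - j))) *
      (m - 2 * ((\<Sum>i=1..m. v i) \<bullet> 0))"
    by (rule vertex_walk_bound[OF assms(1,2) sa V anti _ _ zero, where T = "{}"])
      (simp_all add: lam_def)
  then obtain z where z: "z \<in> ?C"
    "Q z \<bullet> z \<ge> m * (\<Sum>j=1..?d. (lam j - lam (Suc j)) * (j / (real m - j)))"
    by (auto simp: mult.commute)
  have "m * (\<Sum>j=1..?d. (lam j - lam (Suc j)) * (j / (real m - j)))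
      = (\<Sum>k=1..?d. frame_coeff m k * ev k)"
    unfolding frame_coeff_summation_by_parts[OF md] by (simp add: lam_def)
  moreover have "continuous_on ?C (\<lambda>x. Q x \<bullet> x)"
    by (intro continuous_intros linear_continuous_on linear_conv_bounded_linear[THEN iffD1] lin)
  then have "\<exists>x\<in>?C. \<forall>y\<in>?C. Q y \<bullet> y \<le> Q x \<bullet> x"
    using compact_frame_polytope[OF assms(2)] zero by (intro continuous_attains_sup) auto
  ultimately show ?thesis
    using z by force
qed

end
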